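(* Let $t_1,t_2\in\mathbb{Z}$. For every prime $\ell$ the limit $$L_\ell(t_1,t_2):=\lim_{k\to\infty}\frac{S(t_1,t_2;\ell^k)}{\ell^{5k-5}}$$ exists. Moreover, for every prime $\ell$ the limit $\lim_{k\to\infty}\ell^{2k}|\Delta(\mathbb{Z}/\ell^k\mathbb{Z})_{t_1,t_2}|/|\Delta(\mathbb{Z}/\ell^k\mathbb{Z})|$ exists, and the constant $$c_{t_1,t_2}:=\frac{1}{\pi^2}\prod_{\ell}\left(\lim_{k\to\infty}\frac{\ell^{2k}\,|\Delta(\mathbb{Z}/\ell^k\mathbb{Z})_{t_1,t_2}|}{|\Delta(\mathbb{Z}/\ell^k\mathbb{Z})|}\right)$$ is given by the convergent Euler product $$c_{t_1,t_2}=\frac{1}{\pi^2}\prod_{\ell}\left(\frac{1}{(\ell-1)^3(\ell+1)^2}\,L_\ell(t_1,t_2)\right),$$ the products being over all primes $\ell$.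
   Context: For a prime $\ell$, an integer $k\ge1$ and $t,u\in\mathbb{Z}/\ell^k\mathbb{Z}$, let $m(t,u;\ell^k)$ be the number of $2\times2$ matrices $A$ with entries in $\mathbb{Z}/\ell^k\mathbb{Z}$ with $\operatorname{tr}(A)=t$ and $\det(A)=u$. For integers $t_1,t_2$ set $S(t_1,t_2;\ell^k):=\sum_{u\in(\mathbb{Z}/\ell^k\mathbb{Z})^*}m(t_1,u;\ell^k)\,m(t_2,u;\ell^k)$. Let $\Delta(\mathbb{Z}/\ell^k\mathbb{Z})=\{(g_1,g_2)\in \mathrm{GL}_2(\mathbb{Z}/\ell^k\mathbb{Z})^2:\det g_1=\det g_2\}$ and $\Delta(\mathbb{Z}/\ell^k\mathbb{Z})_{t_1,t_2}$ the subset of pairs with $\operatorname{tr}g_1=t_1$ and $\operatorname{tr}g_2=t_2$. *)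

theory Defs
  imports "HOL-Analysis.Analysis" "HOL-Number_Theory.Residues"
begin

text \<open>
  The ring of integers modulo \<open>n\<close> is the library's \<open>residue_ring n\<close>, whose carrier consists of the
  least nonnegative residues. A matrix over it is the integer matrix of its
  representatives; its trace and determinant are computed over the integers and are then only
  meaningful up to congruence modulo \<open>n\<close>. Everything is used for \<open>n = \<ell> ^ k > 1\<close>;
  in limits over \<open>k\<close> the degenerate term \<open>k = 0\<close> is irrelevant.
\<close>

definition mats :: "int \<Rightarrow> (int ^ 2 ^ 2) set" where
  "mats n = {A. \<forall>i j. A $ i $ j \<in> carrier (residue_ring n)}"

definition mat_cong :: "int \<Rightarrow> int ^ 2 ^ 2 \<Rightarrow> int ^ 2 ^ 2 \<Rightarrow> bool" where
  "mat_cong n A B \<longleftrightarrow> (\<forall>i j. [A $ i $ j = B $ i $ j] (mod n))"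

definition GL2 :: "int \<Rightarrow> (int ^ 2 ^ 2) set" where
  "GL2 n = {A \<in> mats n. \<exists>B \<in> mats n. mat_cong n (A ** B) (mat 1) \<and> mat_cong n (B ** A) (mat 1)}"

definition mat_count :: "int \<Rightarrow> int \<Rightarrow> int \<Rightarrow> nat" where
  "mat_count t u n = card {A \<in> mats n. [trace A = t] (mod n) \<and> [det A = u] (mod n)}"

definition S :: "int \<Rightarrow> int \<Rightarrow> int \<Rightarrow> nat" where
  "S t1 t2 n = (\<Sum>u \<in> Units (residue_ring n). mat_count t1 u n * mat_count t2 u n)"

definition Delta :: "int \<Rightarrow> ((int ^ 2 ^ 2) \<times> (int ^ 2 ^ 2)) set" where
  "Delta n = {(g1, g2). g1 \<in> GL2 n \<and> g2 \<in> GL2 n \<and> [det g1 = det g2] (mod n)}"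

definition Delta_tr :: "int \<Rightarrow> int \<Rightarrow> int \<Rightarrow> ((int ^ 2 ^ 2) \<times> (int ^ 2 ^ 2)) set" where
  "Delta_tr t1 t2 n =
     {(g1, g2) \<in> Delta n. [trace g1 = t1] (mod n) \<and> [trace g2 = t2] (mod n)}"

definition L_seq :: "int \<Rightarrow> int \<Rightarrow> nat \<Rightarrow> nat \<Rightarrow> real" where
  "L_seq t1 t2 l k = real (S t1 t2 (int l ^ k)) / real l ^ (5 * k - 5)"

definition L :: "int \<Rightarrow> int \<Rightarrow> nat \<Rightarrow> real" where
  "L t1 t2 l = lim (L_seq t1 t2 l)"

definition density_seq :: "int \<Rightarrow> int \<Rightarrow> nat \<Rightarrow> nat \<Rightarrow> real" where
  "density_seq t1 t2 l k =
     real l ^ (2 * k) * real (card (Delta_tr t1 t2 (int l ^ k))) / real (card (Delta (int l ^ k)))"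

text \<open>
  Products over all primes are taken in increasing order, as infinite products over the natural
  numbers in which every non-prime index contributes the factor 1.
\<close>

definition over_primes :: "(nat \<Rightarrow> real) \<Rightarrow> nat \<Rightarrow> real" where
  "over_primes f n = (if prime n then f n else 1)"

definition c_const :: "int \<Rightarrow> int \<Rightarrow> real" where
  "c_const t1 t2 = 1 / pi\<^sup>2 * (\<Prod>l. over_primes (\<lambda>l. lim (density_seq t1 t2 l)) l)"

end

theory Submission
  imports Defs
begin

text \<open>
  For \<open>k \<ge> 1\<close> the group \<open>Delta\<close> has order \<open>\<ell> ^ (7 k - 5) (\<ell> - 1) ^ 3 (\<ell> + 1) ^ 2\<close> and
  \<open>Delta_tr\<close> has \<open>S t1 t2 (\<ell> ^ k)\<close> elements, so the two sequences at \<open>\<ell>\<close> are proportional and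
  both Euler products have the same factors.

  Counting solutions of \<open>b c = n\<close> modulo \<open>\<ell> ^ k\<close> by the valuation of \<open>b\<close> shows that the number of
  matrices of trace \<open>t\<close> and determinant \<open>u\<close>, divided by \<open>\<ell> ^ (2 k)\<close>, is
  \<open>(1 - 1 / \<ell>) (\<rho>(0) + \<dots> + \<rho>(k - 1)) + \<rho>(k)\<close>, where \<open>\<rho>(j)\<close> is the proportion of roots of
  \<open>a (t - a) - u\<close> modulo \<open>\<ell> ^ j\<close>. Since \<open>\<rho>(j) \<le> 2 / \<ell> ^ \<lceil>j / 2\<rceil>\<close>, these normalised counts are
  \<open>1 + O(1 / \<ell>)\<close> and converge geometrically, both uniformly in \<open>u\<close>; this yields the limits.
  The average of the normalised counts over all \<open>u\<close> is exactly \<open>1\<close>, so when they are summed over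
  units the first-order errors cancel up to \<open>O(1 / \<ell>\<^sup>2)\<close>, and every Euler factor is
  \<open>1 + O(1 / \<ell>\<^sup>2)\<close>.
\<close>

subsection \<open>Products modulo a prime power\<close>

lemma real_card_filter:
  "finite A \<Longrightarrow> real (card {x \<in> A. P x}) = (\<Sum>x\<in>A. if P x then 1 else 0)"
  by (simp add: sum.If_cases Int_def)

lemma sum_periodic:
  fixes f :: "int \<Rightarrow> real"
  assumes "m \<ge> 0" and "\<And>x. f (x + m) = f x"
  shows "(\<Sum>x\<in>{0..<int n * m}. f x) = real n * (\<Sum>x\<in>{0..<m}. f x)"
proof (induction n)
  case 0
  then show ?case by simp
next
  case (Suc n)
  have shift: "f (x + int j * m) = f x" for x j
  proof (induction j)
    case (Suc j)
    have "f (x + int (Suc j) * m) = f ((x + int j * m) + m)"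
      by (simp add: algebra_simps)
    then show ?case using Suc assms(2) by simp
  qed simp
  have nn: "0 \<le> int n * m" using assms(1) by simp
  have "{0..<int (Suc n) * m} = {0..<int n * m} \<union> {int n * m..<int n * m + m}"
    using nn assms(1) by (subst ivl_disj_un_two(3)) (simp_all add: algebra_simps)
  moreover have "(\<Sum>x\<in>{int n * m..<int n * m + m}. f x) = (\<Sum>x\<in>{0..<m}. f x)"
    by (rule sum.reindex_bij_witness[where i = "\<lambda>x. x + int n * m" and j = "\<lambda>x. x - int n * m"])
       (auto simp: shift intro: shift[of "_ - int n * m" n, simplified, symmetric])
  ultimately show ?case
    by (simp add: sum.union_disjoint Suc.IH distrib_right)
qed

lemma card_residue_cong:
  fixes q y :: int
  assumes "q > 0"
  shows "card {x \<in> {0..<q}. [x = y] (mod q)} = 1"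
proof -
  have "{x \<in> {0..<q}. [x = y] (mod q)} = {y mod q}"
    using assms by (auto simp: cong_def)
  then show ?thesis by simp
qed

lemma card_linear_cong:
  fixes q a y :: int
  assumes "q > 0" and "coprime a q"
  shows "card {x \<in> {0..<q}. [a * x = y] (mod q)} = 1"
proof -
  obtain b where b: "[a * b = 1] (mod q)"
    using cong_solve_coprime_int[OF assms(2)] by blast
  have "[a * x = y] (mod q) \<longleftrightarrow> [x = b * y] (mod q)" for x
  proof
    assume "[a * x = y] (mod q)"
    then have "[b * (a * x) = b * y] (mod q)" by (rule cong_scalar_left)
    moreover have "[(a * b) * x = 1 * x] (mod q)" using b by (rule cong_scalar_right)
    ultimately show "[x = b * y] (mod q)"
      by (metis cong_sym cong_trans mult.commute mult.left_commute mult_1)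
  next
    assume "[x = b * y] (mod q)"
    then have "[a * x = a * (b * y)] (mod q)" by (rule cong_scalar_left)
    moreover have "[(a * b) * y = 1 * y] (mod q)" using b by (rule cong_scalar_right)
    ultimately show "[a * x = y] (mod q)"
      by (metis cong_trans mult.assoc mult_1)
  qed
  then show ?thesis using card_residue_cong[OF assms(1)] by simp
qed

lemma dvd_cong_iff: "[x = y] (mod q) \<Longrightarrow> d dvd q \<Longrightarrow> d dvd x \<longleftrightarrow> d dvd y" for d :: int
  by (meson cong_dvd_iff cong_dvd_modulus)

lemma card_Times_filter:
  assumes "finite A" "finite B"
  shows "card {(x, y) \<in> A \<times> B. P x y} = (\<Sum>x\<in>A. card {y \<in> B. P x y})"
proof -
  have "{(x, y) \<in> A \<times> B. P x y} = (SIGMA x:A. {y \<in> B. P x y})" by auto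
  then show ?thesis using assms by (simp add: card_SigmaI)
qed

definition prod_count :: "int \<Rightarrow> int \<Rightarrow> nat" where
  "prod_count q n = card {(b, c) \<in> {0..<q} \<times> {0..<q}. [b * c = n] (mod q)}"

lemma prod_count_sum:
  "prod_count q n = (\<Sum>b\<in>{0..<q}. card {c \<in> {0..<q}. [b * c = n] (mod q)})"
  unfolding prod_count_def by (rule card_Times_filter) auto

context
  fixes l :: nat
  assumes l: "prime l"
begin

lemma prime_power_pos: "0 < int l" "0 < int l ^ k"
  using l prime_gt_0_nat by auto

lemma multiples_image: "{b \<in> {0..<int l ^ Suc k}. int l dvd b} = (*) (int l) ` {0..<int l ^ k}"
  using prime_power_pos by (auto simp: image_iff elim!: dvdE simp: zero_le_mult_iff)

lemma card_multiples: "card {b \<in> {0..<int l ^ Suc k}. int l dvd b} = l ^ k"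
  unfolding multiples_image using prime_power_pos by (subst card_image) (auto simp: inj_on_def nat_power_eq)

lemma card_nonmultiples: "card {b \<in> {0..<int l ^ Suc k}. \<not> int l dvd b} = l ^ Suc k - l ^ k"
proof -
  have "{b \<in> {0..<int l ^ Suc k}. \<not> int l dvd b} =
      {0..<int l ^ Suc k} - {b \<in> {0..<int l ^ Suc k}. int l dvd b}" by auto
  also have "card \<dots> = card {0..<int l ^ Suc k} - card {b \<in> {0..<int l ^ Suc k}. int l dvd b}"
    by (rule card_Diff_subset) (rule finite_subset[of _ "{0..<int l ^ Suc k}"], auto)
  finally show ?thesis
    unfolding card_multiples by (simp add: nat_power_eq del: power_Suc)
qed

lemma coprime_power_iff: "coprime b (int l ^ Suc k) \<longleftrightarrow> \<not> int l dvd b"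
proof -
  have "prime (int l)" using l by simp
  then have "coprime (int l) b \<longleftrightarrow> \<not> int l dvd b"
    by (meson coprime_absorb_left not_prime_unit prime_imp_coprime)
  then show ?thesis
    by (simp add: coprime_commute[of b] del: power_Suc)
qed

text \<open>Split by whether \<open>l\<close> divides \<open>b\<close>. A unit \<open>b\<close>
  determines \<open>c\<close>. For \<open>b = l * b'\<close> a solution forces \<open>l\<close> to
  divide \<open>n\<close>; cancelling \<open>l\<close> leaves a congruence modulo
  \<open>l ^ k\<close>, and each of its solutions \<open>c\<close> has \<open>l\<close> lifts modulo
  \<open>l ^ Suc k\<close>.\<close>

lemma prod_count_Suc:
  "prod_count (int l ^ Suc k) n = (l ^ Suc k - l ^ k) +
     (if int l dvd n then l * prod_count (int l ^ k) (n div int l) else 0)"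
proof -
  let ?q = "int l ^ k" and ?Q = "int l ^ Suc k"
  let ?c = "\<lambda>b. card {c \<in> {0..<?Q}. [b * c = n] (mod ?Q)}"
  have unit: "?c b = 1" if "\<not> int l dvd b" for b
    by (intro card_linear_cong) (use prime_power_pos that coprime_power_iff in \<open>auto simp del: power_Suc\<close>)
  have mult: "?c (int l * b) =
      (if int l dvd n then l * card {c \<in> {0..<?q}. [b * c = n div int l] (mod ?q)} else 0)" for b
  proof (cases "int l dvd n")
    case True
    define m where "m = n div int l"
    have n: "n = int l * m" using True by (simp add: m_def)
    have iff: "[int l * b * c = n] (mod ?Q) \<longleftrightarrow> [b * c = m] (mod ?q)" for c
      using prime_power_pos(1) by (simp add: n cong_iff_dvd_diff mult.assoc flip: right_diff_distrib)
    have "real (?c (int l * b)) = (\<Sum>c\<in>{0..<int l * ?q}. if [b * c = m] (mod ?q) then 1 else 0)"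
      unfolding iff by (subst real_card_filter) simp_all
    also have "\<dots> = real l * (\<Sum>c\<in>{0..<?q}. if [b * c = m] (mod ?q) then 1 else 0)"
      by (rule sum_periodic) (simp_all add: cong_def distrib_left)
    also have "\<dots> = real (l * card {c \<in> {0..<?q}. [b * c = m] (mod ?q)})"
      using real_card_filter[of "{0..<?q}" "\<lambda>c. [b * c = m] (mod ?q)"] by simp
    finally show ?thesis using True unfolding m_def by (simp only: of_nat_eq_iff if_True)
  next
    case False
    have "\<not> [int l * b * c = n] (mod ?Q)" for c
      using False dvd_cong_iff[of "int l * b * c" n ?Q "int l"] by auto
    then show ?thesis using False by simp
  qed
  have "prod_count ?Q n = (\<Sum>b\<in>{b \<in> {0..<?Q}. \<not> int l dvd b}. ?c b) + (\<Sum>b\<in>{b \<in> {0..<?Q}. int l dvd b}. ?c b)"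
    unfolding prod_count_sum
    by (subst sum.union_disjoint[symmetric])
       (auto intro!: sum.cong finite_subset[of _ "{0..<?Q}"] simp del: power_Suc)
  also have "(\<Sum>b\<in>{b \<in> {0..<?Q}. \<not> int l dvd b}. ?c b) = (\<Sum>b\<in>{b \<in> {0..<?Q}. \<not> int l dvd b}. 1)"
    by (intro sum.cong refl unit) blast
  also have "\<dots> = l ^ Suc k - l ^ k"
    unfolding sum_constant card_nonmultiples by simp
  also have "(\<Sum>b\<in>{b \<in> {0..<?Q}. int l dvd b}. ?c b) = (\<Sum>b\<in>{0..<?q}. ?c (int l * b))"
    unfolding multiples_image using prime_power_pos by (subst sum.reindex) (auto simp: inj_on_def)
  also have "\<dots> = (if int l dvd n then l * prod_count ?q (n div int l) else 0)"
    unfolding mult prod_count_sum by (cases "int l dvd n") (simp_all only: sum_distrib_left if_True if_False sum.neutral_const)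
  finally show ?thesis .
qed

text \<open>Unrolling the recursion sorts solutions by the valuation \<open>j\<close> of
  \<open>b\<close>. There are \<open>(1 - 1 / l) * l ^ (k - j)\<close> such \<open>b\<close>, each
  with \<open>l ^ j\<close> values of \<open>c\<close> when \<open>l ^ j\<close> divides
  \<open>n\<close>, so the powers combine to \<open>l ^ k\<close> for every \<open>j\<close>. The
  last summand is \<open>b = 0\<close>.\<close>

lemma prod_count_eq:
  "real (prod_count (int l ^ k) n) =
     (\<Sum>j<k. if int l ^ j dvd n then (1 - 1 / l) * l ^ k else 0) + (if int l ^ k dvd n then l ^ k else 0)"
proof (induction k arbitrary: n)
  case 0
  have "{(b, c) \<in> {0..<int l ^ 0} \<times> {0..<int l ^ 0}. [b * c = n] (mod int l ^ 0)} = {(0, 0)}"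
    by auto
  then show ?case by (simp add: prod_count_def)
next
  case (Suc k)
  have le: "l ^ k \<le> l ^ Suc k" using prime_gt_0_nat[OF l] by simp
  have l0: "real l \<noteq> 0" using prime_power_pos by simp
  have unit: "real (l ^ Suc k - l ^ k) = (1 - 1 / l) * real (l ^ Suc k)"
    using le l0 by (simp add: of_nat_diff field_simps)
  show ?case
  proof (cases "int l dvd n")
    case True
    then obtain m where m: "n = int l * m" by blast
    have [simp]: "n div int l = m" using m prime_power_pos(1) by simp
    have d: "int l ^ Suc j dvd n \<longleftrightarrow> int l ^ j dvd m" for j
      using prime_power_pos(1) by (simp add: m)
    have "(\<Sum>j<k. if int l ^ j dvd m then (1 - 1 / l) * real (l ^ Suc k) else 0) =
        l * (\<Sum>j<k. if int l ^ j dvd m then (1 - 1 / l) * real (l ^ k) else 0)"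
      unfolding sum_distrib_left by (intro sum.cong) auto
    then show ?thesis
      using True unit
      by (subst sum.lessThan_Suc_shift)
         (simp add: prod_count_Suc Suc d distrib_left del: power_Suc, simp)
  next
    case False
    then have "\<not> int l ^ Suc j dvd n" for j
      by (metis dvd_mult_left power_Suc)
    then show ?thesis using False unit
      by (subst sum.lessThan_Suc_shift) (simp add: prod_count_Suc del: power_Suc)
  qed
qed

end

subsection \<open>Counting matrices\<close>

text \<open>Parametrising matrices by quadruples turns matrix counts into counts of integer tuples,
  which can be summed fibre by fibre.\<close>

definition mk_mat :: "int \<times> int \<times> int \<times> int \<Rightarrow> int ^ 2 ^ 2" where
  "mk_mat = (\<lambda>(a, b, c, d). vector [vector [a, b], vector [c, d]])"

lemma mk_mat_entries [simp]:
  "mk_mat (a, b, c, d) $ 1 $ 1 = a" "mk_mat (a, b, c, d) $ 1 $ 2 = b"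
  "mk_mat (a, b, c, d) $ 2 $ 1 = c" "mk_mat (a, b, c, d) $ 2 $ 2 = d"
  by (simp_all add: mk_mat_def)

lemma mk_mat_eta: "mk_mat (A $ 1 $ 1, A $ 1 $ 2, A $ 2 $ 1, A $ 2 $ 2) = A"
  by (simp add: vec_eq_iff forall_2)

lemma mats_iff:
  "A \<in> mats n \<longleftrightarrow> A $ 1 $ 1 \<in> {0..<n} \<and> A $ 1 $ 2 \<in> {0..<n} \<and> A $ 2 $ 1 \<in> {0..<n} \<and> A $ 2 $ 2 \<in> {0..<n}"
  by (auto simp: mats_def residue_ring_def forall_2)

lemma bij_betw_mk_mat:
  "bij_betw mk_mat
     {(a, b, c, d) \<in> {0..<n} \<times> {0..<n} \<times> {0..<n} \<times> {0..<n}. P (mk_mat (a, b, c, d))}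
     {A \<in> mats n. P A}"
  by (rule bij_betw_byWitness[where f' = "\<lambda>A. (A $ 1 $ 1, A $ 1 $ 2, A $ 2 $ 1, A $ 2 $ 2)"])
     (auto simp: mats_iff mk_mat_eta)

lemma finite_mats [simp]: "finite (mats n)"
proof -
  have "finite {(a, b, c, d) \<in> {0..<n} \<times> {0..<n} \<times> {0..<n} \<times> {0..<n}. True}"
    by (rule finite_subset[of _ "{0..<n} \<times> {0..<n} \<times> {0..<n} \<times> {0..<n}"]) auto
  then show ?thesis
    using bij_betw_finite[OF bij_betw_mk_mat[of n "\<lambda>_. True"]] by simp
qed

lemma trace_2: "trace A = A $ 1 $ 1 + A $ 2 $ 2" for A :: "int ^ 2 ^ 2"
  by (simp add: trace_def sum_2)

text \<open>Keeping \<open>(b, c)\<close> as one variable lets \<open>card_Times_filter\<close> and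
  \<open>sum_card_swap\<close> use the pair as a single index.\<close>

lemma prod_count_alt:
  "prod_count q n = card {bc \<in> {0..<q} \<times> {0..<q}. [fst bc * snd bc = n] (mod q)}"
  unfolding prod_count_def by (rule arg_cong[of _ _ card]) auto

text \<open>The trace condition forces \<open>d\<close> to be \<open>(t - a) mod q\<close>, after
  which the determinant condition says that \<open>b * c\<close> is congruent to
  \<open>a * (t - a) - u\<close>.\<close>

lemma mat_count_eq:
  assumes "q > 0"
  shows "mat_count t u q = (\<Sum>a\<in>{0..<q}. prod_count q (a * (t - a) - u))"
proof -
  let ?R = "{0..<q}"
  have iff: "[a * ((t - a) mod q) - b * c = u] (mod q) \<longleftrightarrow> [b * c = a * (t - a) - u] (mod q)" for a b c
  proof -
    have "[a * ((t - a) mod q) - b * c = a * (t - a) - b * c] (mod q)"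
      by (intro cong_diff cong_mult) (simp_all add: cong_def)
    then have "[a * ((t - a) mod q) - b * c = u] (mod q) \<longleftrightarrow> [a * (t - a) - b * c = u] (mod q)"
      by (simp add: cong_def)
    also have "\<dots> \<longleftrightarrow> q dvd - (b * c - (a * (t - a) - u))"
      unfolding cong_iff_dvd_diff by (simp add: algebra_simps)
    finally show ?thesis by (simp only: dvd_minus_iff cong_iff_dvd_diff)
  qed
  have tr: "d = (t - a) mod q" if "[a + d = t] (mod q)" "d \<in> ?R" for a d
    using that by (metis add_diff_cancel_left' atLeastLessThan_iff cong_def mod_diff_left_eq mod_pos_pos_trivial)
  have tr': "[a + (t - a) mod q = t] (mod q)" for a
    by (simp add: cong_def mod_add_right_eq)
  have R: "(t - a) mod q \<in> ?R" for a using assms by simp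
  have "mat_count t u q = card {(a, b, c, d) \<in> ?R \<times> ?R \<times> ?R \<times> ?R. [a + d = t] (mod q) \<and> [a * d - b * c = u] (mod q)}"
    unfolding mat_count_def
    using bij_betw_same_card[OF bij_betw_mk_mat[of q "\<lambda>A. [trace A = t] (mod q) \<and> [det A = u] (mod q)"]]
    by (simp add: det_2 trace_2)
  also have "\<dots> = card {(a, bc) \<in> ?R \<times> (?R \<times> ?R). [fst bc * snd bc = a * (t - a) - u] (mod q)}"
    by (rule bij_betw_same_card[OF bij_betw_byWitness[where f = "\<lambda>(a, b, c, d). (a, b, c)" and
             f' = "\<lambda>(a, b, c). (a, b, c, (t - a) mod q)"]])
       (use R in \<open>auto simp: iff tr' dest!: tr simp del: atLeastLessThan_iff\<close>)
  also have "\<dots> = (\<Sum>a\<in>?R. card {bc \<in> ?R \<times> ?R. [fst bc * snd bc = a * (t - a) - u] (mod q)})"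
    by (rule card_Times_filter) auto
  finally show ?thesis unfolding prod_count_alt .
qed

lemma sum_card_swap:
  assumes "finite A" "finite B"
  shows "(\<Sum>x\<in>A. card {y \<in> B. P x y}) = (\<Sum>y\<in>B. card {x \<in> A. P x y})"
proof -
  have "real (\<Sum>x\<in>A. card {y \<in> B. P x y}) = (\<Sum>x\<in>A. \<Sum>y\<in>B. if P x y then 1 else 0)"
    using assms by (simp add: real_card_filter)
  also have "\<dots> = (\<Sum>y\<in>B. \<Sum>x\<in>A. if P x y then 1 else 0)" by (rule sum.swap)
  also have "\<dots> = real (\<Sum>y\<in>B. card {x \<in> A. P x y})"
    using assms by (simp add: real_card_filter)
  finally show ?thesis by (simp only: of_nat_eq_iff)
qed

lemma cong_diff_swap: "[x = y - u] (mod q) \<longleftrightarrow> [u = y - x] (mod q)" for x y u q :: int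
  by (simp add: cong_iff_dvd_diff algebra_simps)

lemma cong_diff_swap': "[x - y = u] (mod q) \<longleftrightarrow> [y = x - u] (mod q)" for x y u q :: int
  using dvd_minus_iff[of q "x - y - u"] by (simp add: cong_iff_dvd_diff algebra_simps)

text \<open>The entries \<open>a\<close>, \<open>b\<close>, \<open>c\<close> are free: the trace
  fixes \<open>d\<close>, and the determinant then fixes \<open>u\<close>. This exact total is what
  later makes first-order errors cancel.\<close>

lemma sum_mat_count:
  assumes "q > 0"
  shows "(\<Sum>u\<in>{0..<q}. mat_count t u q) = nat q ^ 3"
proof -
  let ?R = "{0..<q}"
  have "(\<Sum>u\<in>?R. prod_count q (x - u)) = nat q ^ 2" for x
  proof -
    have "(\<Sum>u\<in>?R. prod_count q (x - u)) =
        (\<Sum>u\<in>?R. card {bc \<in> ?R \<times> ?R. [fst bc * snd bc = x - u] (mod q)})"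
      unfolding prod_count_alt ..
    also have "\<dots> = (\<Sum>bc\<in>?R \<times> ?R. card {u \<in> ?R. [fst bc * snd bc = x - u] (mod q)})"
      by (rule sum_card_swap) auto
    also have "\<dots> = (\<Sum>bc\<in>?R \<times> ?R. card {u \<in> ?R. [u = x - fst bc * snd bc] (mod q)})"
      by (subst cong_diff_swap) (rule refl)
    also have "\<dots> = nat q ^ 2"
      using assms by (simp only: card_residue_cong) (simp add: card_cartesian_product power2_eq_square)
    finally show ?thesis .
  qed
  then show ?thesis
    using assms by (simp add: mat_count_eq) (subst sum.swap, simp add: power2_eq_square power3_eq_cube)
qed

section \<open>Invertible matrices and the order of \<open>Delta\<close>\<close>

lemma GL2_eq:
  assumes "q > 0"
  shows "GL2 q = {A \<in> mats q. coprime (det A) q}"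
proof (intro Set.set_eqI iffI)
  fix A assume "A \<in> GL2 q"
  then obtain B where A: "A \<in> mats q" and AB: "mat_cong q (A ** B) (mat 1)"
    by (auto simp: GL2_def)
  have "[det (A ** B) = det (mat 1 :: int ^ 2 ^ 2)] (mod q)"
    unfolding det_2 using AB unfolding mat_cong_def by (intro cong_diff cong_mult) auto
  then have "[det A * det B = 1] (mod q)" by (simp add: det_mul)
  then have "coprime (det A * det B) q"
    by (metis coprime_1_left cong_imp_coprime cong_sym)
  then show "A \<in> {A \<in> mats q. coprime (det A) q}" using A by simp
next
  fix A assume "A \<in> {A \<in> mats q. coprime (det A) q}"
  then have A: "A \<in> mats q" and cop: "coprime (det A) q" by auto
  obtain i where i: "[det A * i = 1] (mod q)"
    using cong_solve_coprime_int[OF cop] by blast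
  \<comment> \<open>The inverse of the determinant times the adjugate, reduced to least
    residues.\<close>
  define B where "B = mk_mat (A $ 2 $ 2 * i mod q, - A $ 1 $ 2 * i mod q, - A $ 2 $ 1 * i mod q, A $ 1 $ 1 * i mod q)"
  have B: "B \<in> mats q" using assms by (simp add: mats_iff B_def)
  have red: "[x * (y mod q) + z * (v mod q) = r] (mod q) \<longleftrightarrow> [x * y + z * v = r] (mod q)" for x y z v r
  proof -
    have "[x * (y mod q) + z * (v mod q) = x * y + z * v] (mod q)"
      by (intro cong_add cong_mult) (simp_all add: cong_def)
    then show ?thesis by (simp add: cong_def)
  qed
  have red': "[(y mod q) * x + (v mod q) * z = r] (mod q) \<longleftrightarrow> [y * x + v * z = r] (mod q)" for x y z v r
    using red[of x y z v r] by (simp add: mult.commute)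
  have "mat_cong q (A ** B) (mat 1)" "mat_cong q (B ** A) (mat 1)"
    using i by (auto simp: mat_cong_def forall_2 B_def matrix_matrix_mult_def sum_2 mat_def red red' det_2 algebra_simps)
  then show "A \<in> GL2 q" using A B by (auto simp: GL2_def)
qed

lemma Units_residue_ring:
  assumes "q > 1"
  shows "Units (residue_ring q) = {u \<in> {0..<q}. coprime u q}"
proof -
  interpret residues q "residue_ring q" by unfold_locales (use assms in auto)
  show ?thesis using assms by (auto simp: res_units_eq order_le_less)
qed

text \<open>The pairs are partitioned by the unit class of their common determinant. The predicates
  are kept general so that the trivial choice gives \<open>Delta\<close> and trace conditions give
  \<open>Delta_tr\<close>.\<close>

lemma card_det_pairs:
  assumes "q > 1"
  shows "card {(A, B). A \<in> GL2 q \<and> B \<in> GL2 q \<and> [det A = det B] (mod q) \<and> P A \<and> Q B} =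
    (\<Sum>u\<in>Units (residue_ring q). card {A \<in> mats q. P A \<and> [det A = u] (mod q)} *
        card {B \<in> mats q. Q B \<and> [det B = u] (mod q)})"
proof -
  let ?X = "\<lambda>u. {A \<in> mats q. P A \<and> [det A = u] (mod q)} \<times> {B \<in> mats q. Q B \<and> [det B = u] (mod q)}"
  have "{(A, B). A \<in> GL2 q \<and> B \<in> GL2 q \<and> [det A = det B] (mod q) \<and> P A \<and> Q B} =
      (\<Union>u\<in>Units (residue_ring q). ?X u)" (is "?L = ?R")
  proof (intro Set.set_eqI iffI)
    fix AB assume "AB \<in> ?L"
    then obtain A B where AB: "AB = (A, B)" "A \<in> mats q" "B \<in> mats q" "coprime (det A) q"
        "[det A = det B] (mod q)" "P A" "Q B"
      using assms by (auto simp: GL2_eq)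
    moreover from this have "coprime (det A mod q) q" using assms by simp
    ultimately have "det A mod q \<in> Units (residue_ring q)" and "AB \<in> ?X (det A mod q)"
      using assms by (auto simp: Units_residue_ring cong_def)
    then show "AB \<in> ?R" by blast
  next
    fix AB assume "AB \<in> ?R"
    then obtain A B u where "AB = (A, B)" "A \<in> mats q" "B \<in> mats q" "coprime u q"
        "[det A = u] (mod q)" "[det B = u] (mod q)" "P A" "Q B"
      using assms by (auto simp: Units_residue_ring)
    then show "AB \<in> ?L"
      using assms by (auto simp: GL2_eq intro: cong_trans cong_sym cong_imp_coprime[OF cong_sym])
  qed
  also have "card \<dots> = (\<Sum>u\<in>Units (residue_ring q). card (?X u))"
  proof (rule card_UN_disjoint)
    show "\<forall>u\<in>Units (residue_ring q). \<forall>v\<in>Units (residue_ring q). u \<noteq> v \<longrightarrow> ?X u \<inter> ?X v = {}"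
      using assms by (auto simp: Units_residue_ring cong_def)
    show "finite (Units (residue_ring q))"
      unfolding Units_residue_ring[OF assms] by (rule finite_subset[of _ "{0..<q}"]) auto
    show "\<forall>u\<in>Units (residue_ring q). finite (?X u)"
      by (auto intro!: finite_cartesian_product finite_subset[OF _ finite_mats[of q]])
  qed
  finally show ?thesis by (simp add: card_cartesian_product)
qed

lemma card_Delta_tr:
  assumes "q > 1"
  shows "card (Delta_tr t1 t2 q) = S t1 t2 q"
  using card_det_pairs[OF assms, where P = "\<lambda>A. [trace A = t1] (mod q)" and Q = "\<lambda>B. [trace B = t2] (mod q)"]
  by (simp add: Delta_tr_def Delta_def S_def mat_count_def conj_assoc)

context
  fixes l :: nat
  assumes l: "prime l"
begin

text \<open>Choose the first row \<open>(a, b)\<close>. If one of its entries is prime to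
  \<open>l\<close>, the determinant condition is a linear congruence in the second row with as many
  solutions as the modulus. If both are divisible by \<open>l\<close>, so is the determinant, which
  is impossible for \<open>u\<close>. It remains to count the rows of the first kind.\<close>

lemma card_det:
  assumes u: "\<not> int l dvd u"
  shows "card {A \<in> mats (int l ^ Suc k). [det A = u] (mod int l ^ Suc k)} =
    (l ^ (2 * Suc k) - l ^ (2 * k)) * l ^ Suc k"
proof -
  define q where "q = int l ^ Suc k"
  let ?R = "{0..<q}"
  have q: "q > 0" "int l dvd q" "nat q = l ^ Suc k"
    using prime_power_pos(2)[OF l, of "Suc k"] by (auto simp: q_def nat_power_eq nat_mult_distrib)
  have cop: "coprime a q \<longleftrightarrow> \<not> int l dvd a" for a
    unfolding q_def by (rule coprime_power_iff[OF l])
  define cnt where "cnt a b = card {(c, d) \<in> ?R \<times> ?R. [a * d - b * c = u] (mod q)}" for a b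
  let ?D = "{a \<in> ?R. int l dvd a}"
  have 1: "cnt a b = nat q" if "\<not> int l dvd a" for a b
  proof -
    have "cnt a b = (\<Sum>c\<in>?R. card {d \<in> ?R. [a * d - b * c = u] (mod q)})"
      unfolding cnt_def by (rule card_Times_filter) auto
    also have "\<dots> = (\<Sum>c\<in>?R. card {d \<in> ?R. [a * d = b * c + u] (mod q)})"
      by (simp add: cong_iff_dvd_diff algebra_simps)
    also have "\<dots> = (\<Sum>c\<in>?R. 1)"
      by (intro sum.cong refl card_linear_cong) (use q cop that in auto)
    finally show ?thesis by simp
  qed
  have 2: "cnt a b = nat q" if "\<not> int l dvd b" for a b
  proof -
    have "cnt a b = card {(d, c) \<in> ?R \<times> ?R. [a * d - b * c = u] (mod q)}"
      unfolding cnt_def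
      by (rule bij_betw_same_card[OF bij_betw_byWitness[where f = prod.swap and f' = prod.swap]]) auto
    also have "\<dots> = (\<Sum>d\<in>?R. card {c \<in> ?R. [a * d - b * c = u] (mod q)})"
      by (rule card_Times_filter) auto
    also have "\<dots> = (\<Sum>d\<in>?R. card {c \<in> ?R. [b * c = a * d - u] (mod q)})"
      by (subst cong_diff_swap') (rule refl)
    also have "\<dots> = (\<Sum>d\<in>?R. 1)"
      by (intro sum.cong refl card_linear_cong) (use q cop that in auto)
    finally show ?thesis by simp
  qed
  have 3: "cnt a b = 0" if "int l dvd a" "int l dvd b" for a b
  proof -
    have "\<not> [a * d - b * c = u] (mod q)" for c d
      using that u dvd_cong_iff[of "a * d - b * c" u q "int l"] q(2) by auto
    then show ?thesis by (simp add: cnt_def)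
  qed
  have cD: "card ?D = l ^ k" unfolding q_def by (rule card_multiples[OF l])
  have "card {A \<in> mats q. [det A = u] (mod q)} =
      card {(a, b, c, d) \<in> ?R \<times> ?R \<times> ?R \<times> ?R. [a * d - b * c = u] (mod q)}"
    using bij_betw_same_card[OF bij_betw_mk_mat[of q "\<lambda>A. [det A = u] (mod q)"]]
    by (simp add: det_2)
  also have "\<dots> = card {(ab, cd) \<in> (?R \<times> ?R) \<times> (?R \<times> ?R). [fst ab * snd cd - snd ab * fst cd = u] (mod q)}"
    by (rule bij_betw_same_card[OF bij_betw_byWitness[where f = "\<lambda>(a, b, c, d). ((a, b), (c, d))"
            and f' = "\<lambda>((a, b), (c, d)). (a, b, c, d)"]]) auto
  also have "\<dots> = (\<Sum>ab\<in>?R \<times> ?R. card {cd \<in> ?R \<times> ?R. [fst ab * snd cd - snd ab * fst cd = u] (mod q)})"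
    by (rule card_Times_filter) auto
  also have "\<dots> = (\<Sum>ab\<in>?R \<times> ?R. cnt (fst ab) (snd ab))"
    unfolding cnt_def by (intro sum.cong refl arg_cong[of _ _ card]) auto
  also have "\<dots> = (\<Sum>ab\<in>?R \<times> ?R - ?D \<times> ?D. cnt (fst ab) (snd ab))"
    by (rule sum.mono_neutral_right) (auto simp: 3)
  also have "\<dots> = (\<Sum>ab\<in>?R \<times> ?R - ?D \<times> ?D. nat q)"
    by (rule sum.cong[OF refl]) (use 1 2 in \<open>auto, metis+\<close>)
  also have "\<dots> = card (?R \<times> ?R - ?D \<times> ?D) * nat q"
    by simp
  also have "card (?R \<times> ?R - ?D \<times> ?D) = card (?R \<times> ?R) - card (?D \<times> ?D)"
    by (rule card_Diff_subset) (auto intro!: finite_cartesian_product finite_subset[of _ ?R])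
  also have "\<dots> = nat q * nat q - l ^ k * l ^ k"
    using cD by (simp only: card_cartesian_product) simp
  finally show ?thesis
    unfolding q(3) unfolding q_def by (simp add: power_mult power2_eq_square power_mult_distrib mult_ac)
qed

lemma card_units: "card (Units (residue_ring (int l ^ Suc k))) = l ^ Suc k - l ^ k"
proof -
  have "int l ^ Suc k > 1" using prime_gt_1_nat[OF l] by (intro one_less_power) auto
  then show ?thesis
    using card_nonmultiples[OF l, of k] by (simp only: Units_residue_ring coprime_power_iff[OF l])
qed

text \<open>Every unit determinant has equally many matrices, so the order is the number of units
  times the square of that number. The exponent \<open>7 * k + 2\<close> is
  \<open>7 * Suc k - 5\<close>.\<close>

lemma card_Delta:
  "real (card (Delta (int l ^ Suc k))) =
     real l ^ (7 * k + 2) * ((real l - 1) ^ 3 * (real l + 1) ^ 2)"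
proof -
  let ?q = "int l ^ Suc k"
  have q: "?q > 1" using prime_gt_1_nat[OF l] by (intro one_less_power) auto
  have l1: "1 \<le> l" using prime_gt_1_nat[OF l] by simp
  have "card (Delta ?q) = (\<Sum>u\<in>Units (residue_ring ?q). card {A \<in> mats ?q. [det A = u] (mod ?q)} *
        card {B \<in> mats ?q. [det B = u] (mod ?q)})"
    using card_det_pairs[OF q, where P = "\<lambda>_. True" and Q = "\<lambda>_. True"] by (simp add: Delta_def)
  also have "\<dots> = (\<Sum>u\<in>Units (residue_ring ?q). ((l ^ (2 * Suc k) - l ^ (2 * k)) * l ^ Suc k)\<^sup>2)"
    by (intro sum.cong refl, subst (1 2) card_det)
       (use q in \<open>auto simp: Units_residue_ring coprime_power_iff[OF l] power2_eq_square simp del: power_Suc\<close>)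
  also have "\<dots> = (l ^ Suc k - l ^ k) * ((l ^ (2 * Suc k) - l ^ (2 * k)) * l ^ Suc k)\<^sup>2"
    by (simp add: card_units del: power_Suc)
  also have "real \<dots> = real l ^ k * (real l - 1) * ((real l ^ (2 * k) * (real l ^ 2 - 1)) * real l ^ Suc k)\<^sup>2"
  proof -
    have "real (l ^ Suc k - l ^ k) = real l ^ k * (real l - 1)"
      using l1 by (subst of_nat_diff) (auto simp: algebra_simps)
    moreover have "real (l ^ (2 * Suc k) - l ^ (2 * k)) = real l ^ (2 * k) * (real l ^ 2 - 1)"
    proof -
      have "2 * Suc k = 2 * k + 2" by simp
      then have "l ^ (2 * Suc k) = l ^ (2 * k) * l ^ 2" by (simp only: power_add)
      moreover have "l ^ (2 * k) \<le> l ^ (2 * k) * l ^ 2" using l1 by simp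
      ultimately show ?thesis by (simp only: of_nat_diff of_nat_mult of_nat_power right_diff_distrib mult_1_right)
    qed
    ultimately show ?thesis by (simp only: of_nat_mult of_nat_power)
  qed
  also have "\<dots> = real l ^ (7 * k + 2) * ((real l - 1) ^ 3 * (real l + 1) ^ 2)"
  proof -
    have "real l ^ (7 * k + 2) = (real l ^ k) ^ 7 * real l ^ 2"
      by (metis power_add power_mult mult.commute)
    moreover have "real l ^ (2 * k) = (real l ^ k) ^ 2"
      by (metis power_mult mult.commute)
    \<comment> \<open>Here \<open>x\<close> stands for \<open>real l ^ k\<close> and
      \<open>r\<close> for \<open>real l\<close>; all powers of \<open>l\<close> are rewritten in
      these two variables.\<close>
    moreover have "x * (r - 1) * ((x ^ 2 * (r ^ 2 - 1)) * (r * x))\<^sup>2 = x ^ 7 * r ^ 2 * ((r - 1) ^ 3 * (r + 1) ^ 2)" for x r :: real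
    proof -
      have "r ^ 2 - 1 = (r - 1) * (r + 1)" by (simp add: algebra_simps power2_eq_square)
      then show ?thesis by (simp only:) (simp add: eval_nat_numeral mult_ac)
    qed
    ultimately show ?thesis by (simp only: power_Suc)
  qed
  finally show ?thesis .
qed

text \<open>In the order of \<open>Delta\<close> the exponent \<open>7 * k + 2\<close> splits as
  \<open>2 * Suc k + 5 * k\<close>: the first part cancels the normalising power in
  \<open>density_seq\<close>, the second is the denominator of \<open>L_seq\<close>. At a successor
  exponent \<open>5 * Suc k - 5\<close> is not truncated.\<close>

lemma density_seq_eq:
  "density_seq t1 t2 l (Suc k) = 1 / ((real l - 1) ^ 3 * (real l + 1) ^ 2) * L_seq t1 t2 l (Suc k)"
proof -
  have q: "int l ^ Suc k > 1" using prime_gt_1_nat[OF l] by (intro one_less_power) auto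
  have l0: "real l ^ j \<noteq> 0" for j using prime_gt_0_nat[OF l] by simp
  have "density_seq t1 t2 l (Suc k) = real l ^ (2 * Suc k) * S t1 t2 (int l ^ Suc k) /
      (real l ^ (7 * k + 2) * ((real l - 1) ^ 3 * (real l + 1) ^ 2))"
    unfolding density_seq_def card_Delta card_Delta_tr[OF q] ..
  also have "real l ^ (7 * k + 2) = real l ^ (2 * Suc k) * real l ^ (5 * k)"
    by (simp flip: power_add)
  finally show ?thesis using l0[of "2 * Suc k"] by (simp add: L_seq_def del: power_Suc)
qed

end

subsection \<open>Normalised matrix counts\<close>

definition root_count :: "int \<Rightarrow> int \<Rightarrow> int \<Rightarrow> nat" where
  "root_count t u q = card {a \<in> {0..<q}. q dvd a * (t - a) - u}"

text \<open>The terms come in equal consecutive pairs, so removing the first two leaves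
  \<open>x\<close> times a shorter sum; the induction closes because
  \<open>2 * x + 4 * x ^ 2\<close> is at most \<open>4 * x\<close> for \<open>x\<close> up to one
  half.\<close>

lemma sum_power_half_le:
  fixes x :: real
  assumes "0 \<le> x" "x \<le> 1 / 2"
  shows "(\<Sum>j<n. x ^ Suc (j div 2)) \<le> 4 * x"
proof (induction n rule: nat_less_induct)
  case (1 n)
  consider "n = 0" | "n = 1" | m where "n = Suc (Suc m)"
    by (metis One_nat_def not0_implies_Suc)
  then show ?case
  proof cases
    case 3
    have "(\<Sum>j<n. x ^ Suc (j div 2)) = 2 * x + x * (\<Sum>j<m. x ^ Suc (j div 2))"
      unfolding 3 by (subst sum.lessThan_Suc_shift, subst sum.lessThan_Suc_shift) (simp add: sum_distrib_left)
    also have "\<dots> \<le> 2 * x + x * (4 * x)"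
      using 1 3 assms by (intro add_left_mono mult_left_mono) auto
    also have "\<dots> \<le> 4 * x"
      using mult_left_mono[OF assms(2,1)] by simp
    finally show ?thesis .
  qed (use assms in auto)
qed

lemma mat_count_periodic: "mat_count t (u + q) q = mat_count t u q"
  by (simp add: mat_count_def cong_def)

context
  fixes l :: nat
  assumes l: "prime l"
begin

definition eps :: real where "eps = 1 / real l"

lemma eps_bounds: "0 < eps" "eps \<le> 1 / 2"
  using prime_ge_2_nat[OF l] by (auto simp: eps_def field_simps)

definition root_density :: "int \<Rightarrow> int \<Rightarrow> nat \<Rightarrow> real" where
  "root_density t u j = root_count t u (int l ^ j) / real l ^ j"

text \<open>There are \<open>l ^ (4 * k)\<close> matrices and \<open>l ^ (2 * k)\<close> pairs of
  trace and determinant, so this normalisation makes the expected value 1.\<close>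

definition mat_density :: "int \<Rightarrow> nat \<Rightarrow> int \<Rightarrow> real" where
  "mat_density t k u = mat_count t u (int l ^ k) / real l ^ (2 * k)"

lemma card_periodic:
  assumes "j \<le> k" and "\<And>a. P (a + int l ^ j) \<longleftrightarrow> P a"
  shows "card {a \<in> {0..<int l ^ k}. P a} = l ^ (k - j) * card {a \<in> {0..<int l ^ j}. P a}"
proof -
  have "int (l ^ (k - j)) * int l ^ j = int l ^ k"
    using assms(1) by (simp flip: power_add)
  then have "real (card {a \<in> {0..<int l ^ k}. P a}) =
      (\<Sum>a\<in>{0..<int (l ^ (k - j)) * int l ^ j}. if P a then 1 else 0)"
    by (simp only: real_card_filter finite_atLeastLessThan_int)
  also have "\<dots> = real (l ^ (k - j)) * (\<Sum>a\<in>{0..<int l ^ j}. if P a then 1 else 0)"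
    by (rule sum_periodic) (simp_all add: assms(2))
  also have "\<dots> = real (l ^ (k - j) * card {a \<in> {0..<int l ^ j}. P a})"
    by (simp only: real_card_filter finite_atLeastLessThan_int of_nat_mult)
  finally show ?thesis by (simp only: of_nat_eq_iff)
qed

lemma dvd_periodic:
  "int l ^ j dvd (a + int l ^ j) * (t - (a + int l ^ j)) - u \<longleftrightarrow> int l ^ j dvd a * (t - a) - u"
proof -
  have "(a + int l ^ j) * (t - (a + int l ^ j)) - u =
      int l ^ j * (t - 2 * a - int l ^ j) + (a * (t - a) - u)"
    by (simp add: algebra_simps)
  then show ?thesis by (simp only: dvd_add_right_iff[OF dvd_triv_left])
qed

text \<open>One root confines all others to two residue classes modulo \<open>l ^ c\<close>, with
  \<open>c\<close> half of \<open>Suc j\<close> rounded up. The bound is uniform in \<open>t\<close>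
  and \<open>u\<close>, even when the discriminant is divisible by \<open>l\<close>.\<close>

lemma root_count_le: "root_count t u (int l ^ Suc j) \<le> 2 * l ^ (Suc j - Suc (j div 2))"
proof -
  define c where "c = Suc (j div 2)"
  let ?R = "{0..<int l ^ Suc j}"
  let ?f = "\<lambda>y. {a \<in> ?R. [a = y] (mod int l ^ c)}"
  have cf: "card (?f y) = l ^ (Suc j - c)" for y
    using prime_power_pos(2)[OF l, of c]
    by (subst card_periodic[of c]) (simp_all only: card_residue_cong, simp_all add: c_def cong_def)
  show ?thesis
  proof (cases "{a \<in> ?R. int l ^ Suc j dvd a * (t - a) - u} = {}")
    case True
    then show ?thesis unfolding root_count_def by (simp only: card.empty)
  next
    case False
    then obtain b where b: "int l ^ Suc j dvd b * (t - b) - u" by blast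
    \<comment> \<open>\<open>(a - b) (a - (t - b))\<close> is divisible by \<open>\<ell> ^ (j + 1)\<close>, so one of its factors is divisible by \<open>\<ell> ^ c\<close>\<close>
    have "{a \<in> ?R. int l ^ Suc j dvd a * (t - a) - u} \<subseteq> ?f b \<union> ?f (t - b)"
    proof
      fix a assume "a \<in> {a \<in> ?R. int l ^ Suc j dvd a * (t - a) - u}"
      then have a: "a \<in> ?R" "int l ^ Suc j dvd a * (t - a) - u" by blast+
      have "int l ^ Suc j dvd (b * (t - b) - u) - (a * (t - a) - u)"
        using a(2) b by (rule dvd_diff[rotated])
      also have "(b * (t - b) - u) - (a * (t - a) - u) = (a - b) * (a - (t - b))"
        by (simp add: algebra_simps)
      finally obtain m n where mn: "m + n = Suc j" "int l ^ m dvd a - b" "int l ^ n dvd a - (t - b)"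
        using prime_elem_power_dvd_prod[of "int l" "Suc j" "a - b" "a - (t - b)"] l by auto
      have "c \<le> m \<or> c \<le> n" using mn(1) unfolding c_def by linarith
      then have "int l ^ c dvd a - b \<or> int l ^ c dvd a - (t - b)"
        using mn(2,3) by (meson dvd_trans le_imp_power_dvd)
      then show "a \<in> ?f b \<union> ?f (t - b)" using a(1) by (auto simp: cong_iff_dvd_diff)
    qed
    then have "root_count t u (int l ^ Suc j) \<le> card (?f b \<union> ?f (t - b))"
      unfolding root_count_def by (rule card_mono[rotated]) (auto intro: finite_subset[of _ ?R])
    also have "\<dots> \<le> 2 * l ^ (Suc j - c)"
      using card_Un_le[of "?f b" "?f (t - b)"] cf by simp
    finally show ?thesis by (simp only: c_def)
  qed
qed

lemma root_density_nonneg: "0 \<le> root_density t u j"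
  by (simp add: root_density_def)

lemma root_density_0: "root_density t u 0 = 1"
proof -
  have "{0..<int l ^ 0} = {0}" by auto
  then show ?thesis by (simp add: root_density_def root_count_def)
qed

lemma root_density_Suc_le: "root_density t u (Suc j) \<le> 2 * eps ^ Suc (j div 2)"
proof -
  have l0: "0 < real l" using prime_gt_0_nat[OF l] by simp
  have "Suc j = (Suc j - Suc (j div 2)) + Suc (j div 2)" by simp
  then have "real l ^ Suc j = real l ^ (Suc j - Suc (j div 2)) * real l ^ Suc (j div 2)"
    by (metis power_add)
  moreover have "real (root_count t u (int l ^ Suc j)) \<le> 2 * real l ^ (Suc j - Suc (j div 2))"
    using root_count_le[of t u j] by (metis of_nat_le_iff of_nat_mult of_nat_numeral of_nat_power)
  ultimately show ?thesis
    using l0 unfolding root_density_def eps_def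
    by (simp add: field_simps power_divide del: power_Suc)
qed

text \<open>Sum \<open>prod_count_eq\<close> over \<open>a\<close> with
  \<open>n = a * (t - a) - u\<close>. Divisibility by \<open>l ^ j\<close> depends only on
  \<open>a\<close> modulo \<open>l ^ j\<close>, so it holds for a proportion
  \<open>root_density t u j\<close> of all \<open>a\<close>.\<close>

lemma mat_density_eq: "mat_density t k u = (1 - eps) * (\<Sum>j<k. root_density t u j) + root_density t u k"
proof -
  let ?R = "{0..<int l ^ k}"
  have l0: "real l ^ j \<noteq> 0" for j using prime_gt_0_nat[OF l] by simp
  have R: "(\<Sum>a\<in>?R. if int l ^ j dvd a * (t - a) - u then C else 0) = C * (real l ^ k * root_density t u j)"
    if "j \<le> k" for j and C :: real
  proof -
    have "(\<Sum>a\<in>?R. if int l ^ j dvd a * (t - a) - u then C else 0) =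
        C * real (card {a \<in> ?R. int l ^ j dvd a * (t - a) - u})"
      unfolding real_card_filter[OF finite_atLeastLessThan_int] sum_distrib_left
      by (intro sum.cong) auto
    also have "\<dots> = C * (real l ^ (k - j) * real (root_count t u (int l ^ j)))"
      unfolding root_count_def by (subst card_periodic[where P = "\<lambda>a. int l ^ j dvd a * (t - a) - u", OF that dvd_periodic]) simp
    also have "real l ^ (k - j) * real (root_count t u (int l ^ j)) = real l ^ k * root_density t u j"
      using l0[of 1] that by (simp add: root_density_def power_diff)
    finally show ?thesis .
  qed
  have "real (mat_count t u (int l ^ k)) =
      (\<Sum>j<k. \<Sum>a\<in>?R. if int l ^ j dvd a * (t - a) - u then (1 - eps) * real (l ^ k) else 0) +
      (\<Sum>a\<in>?R. if int l ^ k dvd a * (t - a) - u then real (l ^ k) else 0)"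
    unfolding mat_count_eq[OF prime_power_pos(2)[OF l]] of_nat_sum prod_count_eq[OF l] eps_def[symmetric]
    by (simp only: sum.distrib sum.swap[of _ _ ?R] if_distrib[of real] of_nat_0)
  also have "\<dots> = (\<Sum>j<k. ((1 - eps) * real (l ^ k)) * (real l ^ k * root_density t u j)) + real (l ^ k) * (real l ^ k * root_density t u k)"
    by (simp only: R order.refl) (intro arg_cong2[of _ _ _ _ "(+)"] sum.cong refl R, simp)
  also have "\<dots> = real l ^ (2 * k) * ((1 - eps) * (\<Sum>j<k. root_density t u j) + root_density t u k)"
    unfolding mult_2 power_add by (simp add: distrib_left sum_distrib_left mult_ac)
  finally show ?thesis
    using l0[of "2 * k"] by (simp add: mat_density_def)
qed

text \<open>The term \<open>j = 0\<close> contributes exactly \<open>1 - eps\<close>. The remaining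
  terms are nonnegative, and by \<open>root_density_Suc_le\<close> and
  \<open>sum_power_half_le\<close> they add at most \<open>2 * (4 * eps)\<close>.\<close>

lemma mat_density_bound: "\<bar>mat_density t k u - 1\<bar> \<le> 8 * eps"
proof (cases k)
  case 0
  then show ?thesis using eps_bounds by (simp add: mat_density_eq root_density_0)
next
  case (Suc m)
  have 1: "mat_density t k u = (1 - eps) + (1 - eps) * (\<Sum>j<m. root_density t u (Suc j)) + root_density t u (Suc m)"
    unfolding mat_density_eq Suc by (subst sum.lessThan_Suc_shift) (simp add: root_density_0 distrib_left)
  have nn: "0 \<le> (\<Sum>j<m. root_density t u (Suc j))" by (intro sum_nonneg root_density_nonneg)
  have "(1 - eps) * (\<Sum>j<m. root_density t u (Suc j)) \<le> (\<Sum>j<m. root_density t u (Suc j))"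
    using nn eps_bounds by (intro mult_left_le_one_le) auto
  then have "mat_density t k u \<le> (1 - eps) + (\<Sum>j<Suc m. root_density t u (Suc j))"
    unfolding 1 by simp
  also have "(\<Sum>j<Suc m. root_density t u (Suc j)) \<le> (\<Sum>j<Suc m. 2 * eps ^ Suc (j div 2))"
    by (intro sum_mono root_density_Suc_le)
  also have "\<dots> \<le> 2 * (4 * eps)"
    unfolding sum_distrib_left[symmetric]
    using sum_power_half_le[of eps "Suc m"] eps_bounds by (intro mult_left_mono) auto
  finally have "mat_density t k u \<le> 1 + 8 * eps" using eps_bounds by simp
  moreover have "1 - eps \<le> mat_density t k u"
    unfolding 1 using nn eps_bounds root_density_nonneg[of t u "Suc m"] by (simp add: mult_nonneg_nonneg)
  ultimately show ?thesis using eps_bounds by (simp add: abs_le_iff)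
qed

lemma mat_density_abs_le: "\<bar>mat_density t k u\<bar> \<le> 5"
  using mat_density_bound[of t k u] eps_bounds by (simp add: abs_le_iff)

text \<open>Consecutive densities differ by
  \<open>root_density t u (Suc k) - eps * root_density t u k\<close>, a difference of two
  nonnegative numbers that both obey the bound.\<close>

lemma mat_density_Suc: "\<bar>mat_density t (Suc k) u - mat_density t k u\<bar> \<le> 2 * eps ^ Suc (k div 2)"
proof -
  have eq: "mat_density t (Suc k) u - mat_density t k u = root_density t u (Suc k) - eps * root_density t u k"
    by (simp add: mat_density_eq algebra_simps)
  \<comment> \<open>The density at \<open>k > 0\<close> is at most twice \<open>eps\<close> to the
    power \<open>k / 2\<close> rounded up, and the extra factor \<open>eps\<close> raises this to at
    least \<open>Suc (k div 2)\<close>. At \<open>k = 0\<close> the density is 1.\<close>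
  have "eps * root_density t u k \<le> 2 * eps ^ Suc (k div 2)"
  proof (cases k)
    case 0
    then show ?thesis using eps_bounds by (simp add: root_density_0)
  next
    case (Suc m)
    have "eps * root_density t u k \<le> eps * (2 * eps ^ Suc (m div 2))"
      using eps_bounds root_density_Suc_le[of t u m] Suc by (intro mult_left_mono) auto
    also have "\<dots> = 2 * eps ^ Suc (Suc (m div 2))" by simp
    also have "\<dots> \<le> 2 * eps ^ Suc (k div 2)"
      using eps_bounds Suc by (intro mult_left_mono power_decreasing) auto
    finally show ?thesis .
  qed
  moreover have "0 \<le> eps * root_density t u k" using eps_bounds root_density_nonneg by simp
  ultimately show ?thesis
    unfolding eq using root_density_Suc_le[of t u k] root_density_nonneg[of t u "Suc k"] by linarith
qed

lemma mat_density_periodic: "mat_density t k (u + int l ^ k) = mat_density t k u"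
  by (simp add: mat_density_def mat_count_periodic)

lemma sum_mat_density: "(\<Sum>u\<in>{0..<int l ^ k}. mat_density t k u) = real l ^ k"
proof -
  have l0: "real l \<noteq> 0" using prime_gt_0_nat[OF l] by simp
  have "real (\<Sum>u\<in>{0..<int l ^ k}. mat_count t u (int l ^ k)) = real l ^ (3 * k)"
    unfolding sum_mat_count[OF prime_power_pos(2)[OF l]]
    by (simp add: nat_power_eq mult.commute flip: power_mult)
  moreover have "real l ^ (3 * k) = real l ^ (2 * k) * real l ^ k" by (simp flip: power_add)
  ultimately have "(\<Sum>u\<in>{0..<int l ^ k}. mat_density t k u) = real l ^ (2 * k) * real l ^ k / real l ^ (2 * k)"
    by (simp only: mat_density_def sum_divide_distrib[symmetric] of_nat_sum)
  then show ?thesis using l0 by simp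
qed

section \<open>Averages over the units\<close>

definition unit_ind :: "int \<Rightarrow> real" where
  "unit_ind u = (if int l dvd u then 0 else 1)"

text \<open>Marking units by the weight \<open>unit_ind\<close> keeps the sum over all residues, so
  different levels can be compared by periodicity.\<close>

definition unit_avg :: "int \<Rightarrow> int \<Rightarrow> nat \<Rightarrow> real" where
  "unit_avg t1 t2 k = (\<Sum>u\<in>{0..<int l ^ k}. unit_ind u * (mat_density t1 k u * mat_density t2 k u)) / real l ^ k"

text \<open>The two counts contribute \<open>l ^ (4 * Suc k)\<close> and the averaging
  \<open>l ^ Suc k\<close>. Against the denominator \<open>l ^ (5 * k)\<close> a factor
  \<open>l ^ 5\<close> is left over.\<close>

lemma L_seq_eq: "L_seq t1 t2 l (Suc k) = real l ^ 5 * unit_avg t1 t2 (Suc k)"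
proof -
  let ?q = "int l ^ Suc k"
  have q: "?q > 1" using prime_gt_1_nat[OF l] by (intro one_less_power) auto
  have l0: "real l ^ j \<noteq> 0" for j using prime_gt_0_nat[OF l] by simp
  have m: "real (mat_count t u ?q) = real l ^ (2 * Suc k) * mat_density t (Suc k) u" for t u
    using l0[of "2 * Suc k"] by (simp add: mat_density_def del: power_Suc)
  have U: "Units (residue_ring ?q) = {u \<in> {0..<?q}. \<not> int l dvd u}"
    by (simp only: Units_residue_ring[OF q] coprime_power_iff[OF l])
  have "real (S t1 t2 ?q) = (\<Sum>u\<in>{u \<in> {0..<?q}. \<not> int l dvd u}.
      real l ^ (4 * Suc k) * (unit_ind u * (mat_density t1 (Suc k) u * mat_density t2 (Suc k) u)))"
    unfolding S_def U of_nat_sum of_nat_mult m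
  proof (rule sum.cong[OF refl])
    fix u assume "u \<in> {u \<in> {0..<?q}. \<not> int l dvd u}"
    then have "unit_ind u = 1" by (simp add: unit_ind_def)
    moreover have "real l ^ (4 * Suc k) = real l ^ (2 * Suc k) * real l ^ (2 * Suc k)"
      unfolding power_add[symmetric] by (rule arg_cong[of _ _ "(^) (real l)"]) simp
    ultimately show "real l ^ (2 * Suc k) * mat_density t1 (Suc k) u * (real l ^ (2 * Suc k) * mat_density t2 (Suc k) u) =
        real l ^ (4 * Suc k) * (unit_ind u * (mat_density t1 (Suc k) u * mat_density t2 (Suc k) u))"
      by (simp only: mult_1 mult_ac)
  qed
  also have "\<dots> = (\<Sum>u\<in>{0..<?q}. real l ^ (4 * Suc k) * (unit_ind u * (mat_density t1 (Suc k) u * mat_density t2 (Suc k) u)))"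
    by (rule sum.mono_neutral_left) (auto simp: unit_ind_def)
  also have "\<dots> = real l ^ (4 * Suc k) * (real l ^ Suc k * unit_avg t1 t2 (Suc k))"
    using l0[of "Suc k"] unfolding unit_avg_def sum_distrib_left[symmetric] by simp
  also have "\<dots> = real l ^ (5 * k) * (real l ^ 5 * unit_avg t1 t2 (Suc k))"
  proof -
    have "4 * Suc k + Suc k = 5 * k + 5" by simp
    then show ?thesis by (metis mult.assoc power_add)
  qed
  finally show ?thesis using l0[of "5 * k"] by (simp add: L_seq_def)
qed

lemma unit_avg_diff:
  "\<bar>unit_avg t1 t2 (Suc (Suc k)) - unit_avg t1 t2 (Suc k)\<bar> \<le> 20 * eps ^ Suc (k div 2)"
proof -
  let ?k = "Suc k"
  let ?f = "\<lambda>k u. unit_ind u * (mat_density t1 k u * mat_density t2 k u)"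
  let ?R = "{0..<int l ^ Suc ?k}"
  have l0: "0 < real l" using prime_gt_0_nat[OF l] by simp
  \<comment> \<open>The average at the lower level is rewritten over the residues of the higher one,
    so that the difference can be taken term by term. The weight \<open>unit_ind\<close> has period
    \<open>l ^ ?k\<close> because \<open>?k\<close> is positive.\<close>
  have "(\<Sum>u\<in>{0..<int l * int l ^ ?k}. ?f ?k u) = real l * (\<Sum>u\<in>{0..<int l ^ ?k}. ?f ?k u)"
  proof (rule sum_periodic)
    show "?f ?k (u + int l ^ ?k) = ?f ?k u" for u
      unfolding mat_density_periodic by (simp add: unit_ind_def dvd_add_left_iff)
  qed simp
  then have 1: "unit_avg t1 t2 ?k = (\<Sum>u\<in>?R. ?f ?k u) / real l ^ Suc ?k"
    using l0 by (simp add: unit_avg_def)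
  have step: "\<bar>?f (Suc ?k) u - ?f ?k u\<bar> \<le> 20 * eps ^ Suc (k div 2)" for u
  proof -
    have d: "\<bar>mat_density t (Suc ?k) u - mat_density t ?k u\<bar> \<le> 2 * eps ^ Suc (k div 2)" for t
    proof -
      have "eps ^ Suc (?k div 2) \<le> eps ^ Suc (k div 2)"
        using eps_bounds by (intro power_decreasing) (auto intro: div_le_mono)
      then show ?thesis using mat_density_Suc[of t ?k u] by simp
    qed
    \<comment> \<open>Only one factor changes at a time. Each change is at most
      \<open>2 * eps ^ Suc (k div 2)\<close> and the other factor at most 5, which gives the
      constant 20.\<close>
    have "?f (Suc ?k) u - ?f ?k u = unit_ind u * (mat_density t1 (Suc ?k) u * (mat_density t2 (Suc ?k) u - mat_density t2 ?k u) +
        mat_density t2 ?k u * (mat_density t1 (Suc ?k) u - mat_density t1 ?k u))"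
      by (simp add: algebra_simps)
    also have "\<bar>\<dots>\<bar> \<le> 1 * \<bar>mat_density t1 (Suc ?k) u * (mat_density t2 (Suc ?k) u - mat_density t2 ?k u) +
        mat_density t2 ?k u * (mat_density t1 (Suc ?k) u - mat_density t1 ?k u)\<bar>"
      unfolding abs_mult[of "unit_ind u"] by (intro mult_right_mono) (auto simp: unit_ind_def)
    also have "\<dots> \<le> \<bar>mat_density t1 (Suc ?k) u\<bar> * \<bar>mat_density t2 (Suc ?k) u - mat_density t2 ?k u\<bar> +
        \<bar>mat_density t2 ?k u\<bar> * \<bar>mat_density t1 (Suc ?k) u - mat_density t1 ?k u\<bar>"
      unfolding mult_1 abs_mult[symmetric] by (rule abs_triangle_ineq)
    also have "\<dots> \<le> 5 * (2 * eps ^ Suc (k div 2)) + 5 * (2 * eps ^ Suc (k div 2))"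
      by (intro add_mono mult_mono mat_density_abs_le d) auto
    finally show ?thesis by simp
  qed
  have "unit_avg t1 t2 (Suc ?k) - unit_avg t1 t2 ?k = (\<Sum>u\<in>?R. ?f (Suc ?k) u - ?f ?k u) / real l ^ Suc ?k"
    unfolding 1 unfolding unit_avg_def by (simp add: sum_subtractf diff_divide_distrib del: power_Suc)
  also have "\<bar>\<dots>\<bar> \<le> (\<Sum>u\<in>?R. 20 * eps ^ Suc (k div 2)) / real l ^ Suc ?k"
  proof -
    have "\<bar>\<Sum>u\<in>?R. ?f (Suc ?k) u - ?f ?k u\<bar> \<le> (\<Sum>u\<in>?R. 20 * eps ^ Suc (k div 2))"
      by (intro order.trans[OF sum_abs] sum_mono step)
    moreover have "\<bar>real l ^ Suc ?k\<bar> = real l ^ Suc ?k" "0 \<le> real l ^ Suc ?k" by simp_all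
    ultimately show ?thesis by (simp only: abs_divide divide_right_mono)
  qed
  also have "\<dots> = 20 * eps ^ Suc (k div 2)"
    using l0 by (simp add: nat_power_eq del: power_Suc)
  finally show ?thesis .
qed

text \<open>The increments are dominated by a summable series, and the sequence is recovered from
  them by telescoping.\<close>

lemma unit_avg_convergent: "convergent (unit_avg t1 t2)"
proof -
  have "summable (\<lambda>k. eps ^ Suc (k div 2))"
    using eps_bounds by (intro summableI_nonneg_bounded[of _ "4 * eps"] sum_power_half_le) auto
  then have "summable (\<lambda>k. 20 * eps ^ Suc (k div 2))"
    by (rule summable_mult)
  then have "summable (\<lambda>k. unit_avg t1 t2 (Suc (Suc k)) - unit_avg t1 t2 (Suc k))"
    by (rule summable_comparison_test'[where N = 0]) (simp only: real_norm_def unit_avg_diff)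
  then have "convergent (\<lambda>n. \<Sum>k<n. unit_avg t1 t2 (Suc (Suc k)) - unit_avg t1 t2 (Suc k))"
    by (simp add: summable_iff_convergent)
  then have "convergent (\<lambda>n. unit_avg t1 t2 (Suc n) - unit_avg t1 t2 (Suc 0))"
    by (simp only: sum_lessThan_telescope[of "\<lambda>k. unit_avg t1 t2 (Suc k)"])
  then have "convergent (\<lambda>n. unit_avg t1 t2 (Suc n))"
    using convergent_diff_const_right_iff by blast
  then show ?thesis by (simp only: convergent_Suc_iff)
qed

text \<open>The deviations from 1 sum to zero over all residues, so their sum over units is minus
  their sum over multiples of \<open>l\<close>. These are only a fraction \<open>eps\<close> of the
  residues, each deviating by at most \<open>8 * eps\<close>, which gains a second factor
  \<open>eps\<close>.\<close>

lemma sum_unit_ind_mat_density: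
  "\<bar>\<Sum>u\<in>{0..<int l ^ Suc k}. unit_ind u * (mat_density t (Suc k) u - 1)\<bar> \<le> 8 * eps ^ 2 * real l ^ Suc k"
proof -
  let ?R = "{0..<int l ^ Suc k}"
  have l0: "0 < real l" using prime_gt_0_nat[OF l] by simp
  have "(\<Sum>u\<in>?R. mat_density t (Suc k) u - 1) = 0"
    by (simp add: sum_subtractf sum_mat_density nat_power_eq del: power_Suc)
  moreover have "(\<Sum>u\<in>?R. unit_ind u * (mat_density t (Suc k) u - 1)) =
      (\<Sum>u\<in>?R. mat_density t (Suc k) u - 1) - (\<Sum>u\<in>{u \<in> ?R. int l dvd u}. mat_density t (Suc k) u - 1)"
    unfolding sum.inter_filter[OF finite_atLeastLessThan_int] sum_subtractf[symmetric]
    by (rule sum.cong) (auto simp: unit_ind_def)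
  ultimately have "\<bar>\<Sum>u\<in>?R. unit_ind u * (mat_density t (Suc k) u - 1)\<bar> =
      \<bar>\<Sum>u\<in>{u \<in> ?R. int l dvd u}. mat_density t (Suc k) u - 1\<bar>" by (simp only: diff_0 abs_minus_cancel)
  also have "\<dots> \<le> (\<Sum>u\<in>{u \<in> ?R. int l dvd u}. 8 * eps)"
    by (intro order.trans[OF sum_abs] sum_mono mat_density_bound)
  also have "\<dots> = real l ^ k * (8 * eps)"
    by (simp only: sum_constant card_multiples[OF l]) simp
  also have "\<dots> = 8 * eps ^ 2 * real l ^ Suc k"
    using l0 by (simp add: power2_eq_square eps_def)
  finally show ?thesis .
qed

text \<open>Write each density as 1 plus an error and expand the product. The constant term gives
  the proportion of units, each linear term costs \<open>8 * eps ^ 2\<close> by the cancellation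
  above, and the product of errors costs \<open>64 * eps ^ 2\<close>.\<close>

lemma unit_avg_estimate: "\<bar>unit_avg t1 t2 (Suc k) - (1 - eps)\<bar> \<le> 80 * eps ^ 2"
proof -
  let ?q = "real l ^ Suc k"
  let ?R = "{0..<int l ^ Suc k}"
  let ?e = "\<lambda>t u. mat_density t (Suc k) u - 1"
  have l0: "0 < real l" using prime_gt_0_nat[OF l] by simp
  have unit_ind: "(\<Sum>u\<in>?R. unit_ind u) = (1 - eps) * ?q"
  proof -
    have "(\<Sum>u\<in>?R. unit_ind u) = (\<Sum>u\<in>?R. if \<not> int l dvd u then 1 else 0)"
      by (rule sum.cong) (auto simp: unit_ind_def)
    also have "\<dots> = real (l ^ Suc k - l ^ k)"
      by (simp only: real_card_filter[symmetric] finite_atLeastLessThan_int card_nonmultiples[OF l])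
    also have "\<dots> = (1 - eps) * ?q"
      using l0 by (subst of_nat_diff) (auto simp: eps_def field_simps)
    finally show ?thesis .
  qed
  have "unit_avg t1 t2 (Suc k) * ?q = (\<Sum>u\<in>?R. unit_ind u + unit_ind u * ?e t1 u + unit_ind u * ?e t2 u + unit_ind u * (?e t1 u * ?e t2 u))"
    using l0 unfolding unit_avg_def by (simp add: algebra_simps del: power_Suc)
  also have "\<dots> = (1 - eps) * ?q + (\<Sum>u\<in>?R. unit_ind u * ?e t1 u) + (\<Sum>u\<in>?R. unit_ind u * ?e t2 u) +
      (\<Sum>u\<in>?R. unit_ind u * (?e t1 u * ?e t2 u))"
    by (simp only: sum.distrib unit_ind)
  finally have eq: "(unit_avg t1 t2 (Suc k) - (1 - eps)) * ?q = (\<Sum>u\<in>?R. unit_ind u * ?e t1 u) + (\<Sum>u\<in>?R. unit_ind u * ?e t2 u) +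
      (\<Sum>u\<in>?R. unit_ind u * (?e t1 u * ?e t2 u))" by (simp add: algebra_simps)
  have "\<bar>\<Sum>u\<in>?R. unit_ind u * (?e t1 u * ?e t2 u)\<bar> \<le> (\<Sum>u\<in>?R. 64 * eps ^ 2)"
  proof (intro order.trans[OF sum_abs] sum_mono)
    fix u
    have "\<bar>unit_ind u * (?e t1 u * ?e t2 u)\<bar> \<le> 1 * (8 * eps * (8 * eps))"
      unfolding abs_mult using eps_bounds
      by (intro mult_mono mat_density_bound) (auto simp: unit_ind_def)
    then show "\<bar>unit_ind u * (?e t1 u * ?e t2 u)\<bar> \<le> 64 * eps ^ 2"
      by (simp add: power2_eq_square)
  qed
  also have "\<dots> = 64 * eps ^ 2 * ?q" by (simp add: nat_power_eq)
  finally have "\<bar>(unit_avg t1 t2 (Suc k) - (1 - eps)) * ?q\<bar> \<le> 80 * eps ^ 2 * ?q"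
    unfolding eq using sum_unit_ind_mat_density[of t1 k] sum_unit_ind_mat_density[of t2 k] by linarith
  then show ?thesis
    using l0 by (simp add: abs_mult del: power_Suc)
qed

section \<open>Limits and Euler factors\<close>

lemma L_seq_limit:
  obtains A where "L_seq t1 t2 l \<longlonglongrightarrow> real l ^ 5 * A" and "\<bar>A - (1 - eps)\<bar> \<le> 80 * eps ^ 2"
proof -
  obtain A where A: "unit_avg t1 t2 \<longlonglongrightarrow> A"
    using unit_avg_convergent unfolding convergent_def by blast
  then have A': "(\<lambda>k. unit_avg t1 t2 (Suc k)) \<longlonglongrightarrow> A" by (rule LIMSEQ_Suc)
  then have "(\<lambda>k. L_seq t1 t2 l (Suc k)) \<longlonglongrightarrow> real l ^ 5 * A"
    unfolding L_seq_eq by (rule tendsto_mult_left)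
  then have "L_seq t1 t2 l \<longlonglongrightarrow> real l ^ 5 * A" by (rule LIMSEQ_imp_Suc)
  \<comment> \<open>The estimate is uniform in the level and therefore passes to the limit.\<close>
  moreover have "(\<lambda>k. \<bar>unit_avg t1 t2 (Suc k) - (1 - eps)\<bar>) \<longlonglongrightarrow> \<bar>A - (1 - eps)\<bar>"
    by (intro tendsto_intros A')
  then have "\<bar>A - (1 - eps)\<bar> \<le> 80 * eps ^ 2"
    by (rule LIMSEQ_le_const2) (use unit_avg_estimate in blast)
  ultimately show ?thesis using that by blast
qed

lemma L_seq_convergent: "convergent (L_seq t1 t2 l)"
  using L_seq_limit convergentI by metis

lemma density_seq_limit:
  "density_seq t1 t2 l \<longlonglongrightarrow> 1 / ((real l - 1) ^ 3 * (real l + 1) ^ 2) * L t1 t2 l"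
proof -
  have "L_seq t1 t2 l \<longlonglongrightarrow> L t1 t2 l"
    unfolding L_def using L_seq_convergent by (simp add: convergent_LIMSEQ_iff)
  then have "(\<lambda>k. density_seq t1 t2 l (Suc k)) \<longlonglongrightarrow> 1 / ((real l - 1) ^ 3 * (real l + 1) ^ 2) * L t1 t2 l"
    unfolding density_seq_eq[OF l] by (intro tendsto_mult_left LIMSEQ_Suc)
  then show ?thesis by (rule LIMSEQ_imp_Suc)
qed

text \<open>The factor is \<open>A / V\<close>, where \<open>V\<close> is the normalised
  denominator. Both agree with \<open>1 - eps\<close> up to second order, so their first-order terms
  cancel in the quotient.\<close>

lemma euler_factor_bound:
  "\<bar>1 / ((real l - 1) ^ 3 * (real l + 1) ^ 2) * L t1 t2 l - 1\<bar> \<le> 328 * eps ^ 2"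
proof -
  obtain A where A: "L_seq t1 t2 l \<longlonglongrightarrow> real l ^ 5 * A" "\<bar>A - (1 - eps)\<bar> \<le> 80 * eps ^ 2"
    by (rule L_seq_limit)
  have LA: "L t1 t2 l = real l ^ 5 * A" unfolding L_def using A(1) by (rule limI)
  define y where "y = eps"
  have y: "0 < y" "y \<le> 1 / 2" "\<bar>A - (1 - y)\<bar> \<le> 80 * y ^ 2" using eps_bounds A(2) by (simp_all only: y_def)
  \<comment> \<open>This is \<open>(1 - y) ^ 3 * (1 + y) ^ 2\<close>, the denominator divided by
    \<open>l ^ 5\<close>.\<close>
  define V where "V = (1 - y) * (1 - y ^ 2) ^ 2"
  have l0: "0 < real l" using prime_gt_0_nat[OF l] by simp
  have "(real l - 1) ^ 3 * (real l + 1) ^ 2 = real l ^ 5 * V"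
  proof -
    have "real l - 1 = real l * (1 - y)" "real l + 1 = real l * (1 + y)"
      using l0 by (simp_all add: y_def eps_def field_simps)
    moreover have "1 - y ^ 2 = (1 - y) * (1 + y)" by (simp add: algebra_simps power2_eq_square)
    ultimately show ?thesis unfolding V_def by (simp only:) (simp add: eval_nat_numeral mult_ac)
  qed
  then have eq: "1 / ((real l - 1) ^ 3 * (real l + 1) ^ 2) * L t1 t2 l = A / V"
    using l0 by (simp add: LA)
  have y2: "0 \<le> y ^ 2" "y ^ 2 \<le> 1 / 4" using y power_mono[of y "1 / 2" 2] by (auto simp: power_divide)
  have "(3 / 4) ^ 2 \<le> (1 - y ^ 2) ^ 2" using y2 by (intro power_mono) auto
  then have "1 / 2 * (3 / 4) ^ 2 \<le> V" unfolding V_def using y by (intro mult_mono) auto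
  then have V: "1 / 4 \<le> V" by (simp add: power_divide)
  have "(1 - y) - V = (1 - y) * ((2 - y ^ 2) * y ^ 2)"
    unfolding V_def by (simp add: power2_eq_square algebra_simps)
  moreover have "\<bar>(1 - y) * ((2 - y ^ 2) * y ^ 2)\<bar> \<le> 1 * (2 * y ^ 2)"
    unfolding abs_mult using y y2 by (intro mult_mono) auto
  \<comment> \<open>The constant is 80 from the estimate of \<open>A\<close> plus 2 from that of
    \<open>V\<close>; dividing by \<open>V\<close>, which is at least one quarter, gives
    328.\<close>
  ultimately have "\<bar>A - V\<bar> \<le> 82 * y ^ 2" using y(3) by linarith
  also have "\<dots> = 328 * y ^ 2 * (1 / 4)" by simp
  also have "\<dots> \<le> 328 * y ^ 2 * V" using V y2 by (intro mult_left_mono) auto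
  finally have "\<bar>A / V - 1\<bar> \<le> 328 * y ^ 2"
    using V by (simp add: field_simps abs_le_iff)
  then show ?thesis unfolding eq by (simp only: y_def)
qed

end

theorem theorem1p3:
  fixes t1 t2 :: int
  shows "(\<forall>l::nat. prime l \<longrightarrow> convergent (L_seq t1 t2 l)) \<and>
    (\<forall>l::nat. prime l \<longrightarrow> convergent (density_seq t1 t2 l)) \<and>
    convergent_prod (over_primes (\<lambda>l. lim (density_seq t1 t2 l))) \<and>
    convergent_prod (over_primes (\<lambda>l. 1 / ((real l - 1) ^ 3 * (real l + 1) ^ 2) * L t1 t2 l)) \<and>
    c_const t1 t2 =
      1 / pi\<^sup>2 * (\<Prod>l. over_primes (\<lambda>l. 1 / ((real l - 1) ^ 3 * (real l + 1) ^ 2) * L t1 t2 l) l)"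
proof -
  let ?f = "over_primes (\<lambda>l. 1 / ((real l - 1) ^ 3 * (real l + 1) ^ 2) * L t1 t2 l)"
  \<comment> \<open>The two products agree factor by factor, so one convergence proof serves for
    both and the formula for \<open>c_const\<close> follows by rewriting.\<close>
  have eq: "over_primes (\<lambda>l. lim (density_seq t1 t2 l)) = ?f"
    by (auto simp: over_primes_def limI[OF density_seq_limit])
  \<comment> \<open>The majorant has the value 0 at \<open>n = 0\<close>, which is consistent
    because 0 is not prime and its factor is 1.\<close>
  have "summable (\<lambda>n. 328 * inverse (real n ^ 2))"
    by (intro summable_mult inverse_power_summable) simp
  then have "summable (\<lambda>n. norm (?f n - 1))"
  proof (rule summable_comparison_test[rotated], intro exI allI impI)
    fix n :: nat
    show "norm (norm (?f n - 1)) \<le> 328 * inverse (real n ^ 2)"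
      using euler_factor_bound[of n t1 t2] by (auto simp: over_primes_def eps_def power_one_over inverse_eq_divide)
  qed
  then have "convergent_prod ?f"
    by (simp only: abs_convergent_prod_conv_summable[symmetric] abs_convergent_prod_imp_convergent_prod)
  moreover have "convergent (density_seq t1 t2 l)" if "prime l" for l
    using density_seq_limit[OF that] by (rule convergentI)
  ultimately show ?thesis
    unfolding eq c_const_def using L_seq_convergent by blast
qed

end
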